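(* Let $m,n'\ge 1$, $n=\min(m,n')$, and let $X_0\in\mathbb{R}^{m\times n'}$. Let $a_1\le a_2\le\dots\le a_n$ and $b_1\le b_2\le\dots\le b_n$ be non-decreasing sequences of real numbers. Define $f_h:\mathbb{R}^{m\times n'}\to\mathbb{R}$ by $$f_h(X)=\sum_{i=1}^n h_i(\sigma_i(X))+\|X-X_0\|_F^2,\qquad h_i(\sigma)=\begin{cases}2a_i\sigma+b_i,&\sigma\neq 0,\\ 0,&\sigma=0.\end{cases}$$ Then the convex envelope (Fenchel biconjugate) $f_h^{**}$ of $f_h$ is given, for every $X\in\mathbb{R}^{m\times n'}$, by $$f_h^{**}(X)=\mathcal{R}_h(X)+\|X-X_0\|_F^2,$$ where $$\mathcal{R}_h(X)=\max_{Z\in\mathbb{R}^{m\times n'}}\left(\sum_{i=1}^n\min\left(b_i,[\sigma_i(Z)-a_i]_+^2\right)+\|Z\|_F^2-\|X-Z\|_F^2-\sum_{i=1}^n[\sigma_i(Z)-a_i]_+^2\right).$$ Furthermore, the maximization can be reduced to the singular values only: $$\mathcal{R}_h(X)=\max_{z_1\ge z_2\ge\dots\ge z_n\ge 0}\ \sum_{i=1}^n\left(\min\left(b_i,[z_i-a_i]_+^2\right)+z_i^2-(\sigma_i(X)-z_i)^2-[z_i-a_i]_+^2\right).$$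
   Context: For a real matrix $X\in\mathbb{R}^{m\times n'}$, $\sigma_1(X)\ge\sigma_2(X)\ge\dots\ge\sigma_n(X)\ge 0$ denote its $n=\min(m,n')$ singular values in non-increasing order, and $\|\cdot\|_F$ is the Frobenius norm. $[t]_+=\max\{t,0\}$. With the inner product $\langle X,Y\rangle=\operatorname{tr}(X^TY)$, the Fenchel conjugate is $f^*(Y)=\sup_X(\langle Y,X\rangle-f(X))$ and the biconjugate is $f^{**}(X)=\sup_Y(\langle Y,X\rangle-f^*(Y))$. *)

theory Defs
  imports "HOL-Analysis.Analysis" "HOL-Computational_Algebra.Computational_Algebra"
begin

text \<open>
  An \<open>m \<times> n'\<close> real matrix is an element of \<^typ>\<open>real^'n^'m\<close>, with rows indexed by
  \<open>'m\<close> and columns by \<open>'n\<close>.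
  The library's inner product and norm on this type are \<open>tr (X\<^sup>T Y)\<close> and the Frobenius norm:
\<close>

lemma inner_matrix_eq_trace:
  fixes X Y :: "real^'n^'m"
  shows "X \<bullet> Y = trace (transpose X ** Y)"
proof -
  have "trace (transpose X ** Y) = (\<Sum>j\<in>UNIV. \<Sum>i\<in>UNIV. X $ i $ j * Y $ i $ j)"
    by (simp add: trace_def matrix_matrix_mult_def transpose_def)
  also have "\<dots> = (\<Sum>i\<in>UNIV. \<Sum>j\<in>UNIV. X $ i $ j * Y $ i $ j)"
    by (rule sum.swap)
  also have "\<dots> = X \<bullet> Y"
    by (simp add: inner_vec_def)
  finally show ?thesis by simp
qed

lemma norm_matrix_eq_Frobenius:
  fixes X :: "real^'n^'m"
  shows "norm X = sqrt (\<Sum>i\<in>UNIV. \<Sum>j\<in>UNIV. (X $ i $ j)\<^sup>2)"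
  by (simp add: norm_eq_sqrt_inner inner_vec_def power2_eq_square)

definition charpoly :: "real^'n^'n \<Rightarrow> real poly" where
  "charpoly A = det (\<chi> i j. (if i = j then [:0, 1:] else 0) - [:A $ i $ j:])"

text \<open>
  All \<open>CARD('n)\<close> square roots of eigenvalues of \<open>X\<^sup>T X\<close>, repeated according to algebraic
  multiplicity; the singular values are the \<open>min CARD('m) CARD('n)\<close> largest of them.
  Singular values are numbered from 1.
\<close>

definition singular_value_list :: "real^'n^'m \<Rightarrow> real list" where
  "singular_value_list X =
     rev (sorted_list_of_multiset (image_mset sqrt (proots (charpoly (transpose X ** X)))))"

definition singular_value :: "nat \<Rightarrow> real^'n^'m \<Rightarrow> real" where
  "singular_value i X = singular_value_list X ! (i - 1)"

definition fenchel_conjugate :: "('a::real_inner \<Rightarrow> ereal) \<Rightarrow> 'a \<Rightarrow> ereal" where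
  "fenchel_conjugate f Y = (SUP X. ereal (Y \<bullet> X) - f X)"

definition fenchel_biconjugate :: "('a::real_inner \<Rightarrow> ereal) \<Rightarrow> 'a \<Rightarrow> ereal" where
  "fenchel_biconjugate f = fenchel_conjugate (fenchel_conjugate f)"

definition pos_part :: "real \<Rightarrow> real" where
  "pos_part t = max t 0"

definition h :: "(nat \<Rightarrow> real) \<Rightarrow> (nat \<Rightarrow> real) \<Rightarrow> nat \<Rightarrow> real \<Rightarrow> real" where
  "h a b i s = (if s = 0 then 0 else 2 * a i * s + b i)"

definition f_h :: "(nat \<Rightarrow> real) \<Rightarrow> (nat \<Rightarrow> real) \<Rightarrow> real^'n^'m \<Rightarrow> real^'n^'m \<Rightarrow> real" where
  "f_h a b X0 X =
     (\<Sum>i=1..min CARD('m) CARD('n). h a b i (singular_value i X)) + (norm (X - X0))\<^sup>2"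

text \<open>
  \<open>maximum_over f S\<close> is meaningful only if \<open>attains_max f S\<close> holds.
\<close>

definition attains_max :: "('a \<Rightarrow> real) \<Rightarrow> 'a set \<Rightarrow> bool" where
  "attains_max f S \<longleftrightarrow> (\<exists>x\<in>S. \<forall>y\<in>S. f y \<le> f x)"

definition maximum_over :: "('a \<Rightarrow> real) \<Rightarrow> 'a set \<Rightarrow> real" where
  "maximum_over f S = (GREATEST r. r \<in> f ` S)"

definition R_h_objective ::
    "(nat \<Rightarrow> real) \<Rightarrow> (nat \<Rightarrow> real) \<Rightarrow> real^'n^'m \<Rightarrow> real^'n^'m \<Rightarrow> real" where
  "R_h_objective a b X Z =
     (\<Sum>i=1..min CARD('m) CARD('n). min (b i) ((pos_part (singular_value i Z - a i))\<^sup>2))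
     + (norm Z)\<^sup>2 - (norm (X - Z))\<^sup>2
     - (\<Sum>i=1..min CARD('m) CARD('n). (pos_part (singular_value i Z - a i))\<^sup>2)"

definition R_h :: "(nat \<Rightarrow> real) \<Rightarrow> (nat \<Rightarrow> real) \<Rightarrow> real^'n^'m \<Rightarrow> real" where
  "R_h a b X = maximum_over (R_h_objective a b X) UNIV"

definition ordered_nonneg :: "nat \<Rightarrow> (nat \<Rightarrow> real) set" where
  "ordered_nonneg n =
     {z. (\<forall>i\<in>{1..n}. \<forall>j\<in>{1..n}. i \<le> j \<longrightarrow> z j \<le> z i) \<and> (\<forall>i\<in>{1..n}. 0 \<le> z i)}"

definition R_h_reduced_objective ::
    "(nat \<Rightarrow> real) \<Rightarrow> (nat \<Rightarrow> real) \<Rightarrow> real^'n^'m \<Rightarrow> (nat \<Rightarrow> real) \<Rightarrow> real" where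
  "R_h_reduced_objective a b X z =
     (\<Sum>i=1..min CARD('m) CARD('n).
        min (b i) ((pos_part (z i - a i))\<^sup>2) + (z i)\<^sup>2
        - (singular_value i X - z i)\<^sup>2 - (pos_part (z i - a i))\<^sup>2)"

end

theory Submission
  imports Defs
begin

text \<open>
  Completing the square turns the conjugate of \<open>f_h\<close> at \<open>Y\<close> into a supremum of
  \<open>2 \<langle>Z, X\<rangle> - \<parallel>X\<parallel>\<^sup>2 - \<Sum> h\<^sub>i (\<sigma>\<^sub>i X)\<close> with \<open>Z = Y/2 + X0\<close>. Von Neumann's trace inequality, together
  with its sharpness for matrices sharing singular vectors, reduces it to ordered vectors \<open>x\<close>.
  There the problem separates over the indices, and since \<open>a\<close> and \<open>b\<close> increase while \<open>\<sigma> Z\<close>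
  decreases, the separate maximizers \<open>[\<sigma>\<^sub>i Z - a\<^sub>i]\<^sub>+\<close> or \<open>0\<close> are again ordered.
  The same substitution identifies the biconjugate with the maximum over \<open>Z\<close>, which the trace
  inequality again reduces to singular values; it is attained because for each index the
  objective decreases beyond a bound.
\<close>

subsection \<open>Orthonormal families\<close>

definition orthonormal_on :: "'i set \<Rightarrow> ('i \<Rightarrow> 'a::real_inner) \<Rightarrow> bool" where
  "orthonormal_on I e \<longleftrightarrow> (\<forall>i\<in>I. \<forall>j\<in>I. e i \<bullet> e j = (if i = j then 1 else 0))"

lemma orthonormal_on_inner:
  "orthonormal_on I e \<Longrightarrow> i \<in> I \<Longrightarrow> j \<in> I \<Longrightarrow> e i \<bullet> e j = (if i = j then 1 else 0)"
  by (simp add: orthonormal_on_def)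

lemma orthonormal_on_inj: "orthonormal_on I e \<Longrightarrow> inj_on e I"
proof (rule inj_onI, rule ccontr)
  fix i j assume "orthonormal_on I e" "i \<in> I" "j \<in> I" "e i = e j" "i \<noteq> j"
  then show False
    using orthonormal_on_inner[of I e i j] orthonormal_on_inner[of I e i i] by simp
qed

lemma orthonormal_on_insert:
  assumes "orthonormal_on I e" "k \<notin> I" "norm x = 1" "\<And>i. i \<in> I \<Longrightarrow> x \<bullet> e i = 0"
  shows "orthonormal_on (insert k I) (e(k := x))"
  using assms by (auto simp: orthonormal_on_def inner_commute norm_eq_1)

lemma orthonormal_on_residual:
  assumes "orthonormal_on I e" "finite I" "j \<in> I"
  shows "(x - (\<Sum>i\<in>I. (x \<bullet> e i) *\<^sub>R e i)) \<bullet> e j = 0"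
proof -
  have "(\<Sum>i\<in>I. (x \<bullet> e i) *\<^sub>R e i) \<bullet> e j = (\<Sum>i\<in>I. (x \<bullet> e i) * (if i = j then 1 else 0))"
    unfolding inner_sum_left
    by (rule sum.cong) (use assms in \<open>auto simp: orthonormal_on_inner\<close>)
  also have "\<dots> = x \<bullet> e j"
    using assms by (simp add: mult_delta_right)
  finally show ?thesis by (simp add: inner_diff_left)
qed

text \<open>The projection \<open>y\<close> of \<open>x\<close> is orthogonal to
  \<open>x - y\<close>, so the nonnegative number \<open>(x - y) \<bullet> (x - y)\<close> equals
  \<open>x \<bullet> x\<close> minus the sum. It later bounds the row and column sums in the trace
  inequality.\<close>

lemma Bessel_inequality:
  assumes "orthonormal_on I e" "finite I"
  shows "(\<Sum>i\<in>I. (x \<bullet> e i)\<^sup>2) \<le> x \<bullet> x"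
proof -
  define y where "y = (\<Sum>i\<in>I. (x \<bullet> e i) *\<^sub>R e i)"
  have "(x - y) \<bullet> y = (\<Sum>i\<in>I. (x \<bullet> e i) * ((x - y) \<bullet> e i))"
    by (subst (2) y_def) (simp add: inner_sum_right)
  also have "\<dots> = 0"
    unfolding y_def by (rule sum.neutral) (simp add: orthonormal_on_residual[OF assms])
  finally have 1: "(x - y) \<bullet> y = 0" .
  have "0 \<le> (x - y) \<bullet> (x - y)" by simp
  also have "\<dots> = x \<bullet> x - x \<bullet> y"
    using 1 by (simp add: inner_diff_right inner_diff_left inner_commute)
  also have "x \<bullet> y = (\<Sum>i\<in>I. (x \<bullet> e i)\<^sup>2)"
    by (simp add: y_def inner_sum_right power2_eq_square)
  finally show ?thesis by simp
qed

lemma orthonormal_on_independent: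
  fixes e :: "'i \<Rightarrow> 'a::euclidean_space"
  assumes "orthonormal_on I e"
  shows "independent (e ` I)"
proof (rule pairwise_orthogonal_independent)
  show "pairwise orthogonal (e ` I)"
    using assms by (auto simp: pairwise_def orthogonal_def orthonormal_on_def)
  show "0 \<notin> e ` I"
    using assms by (metis imageE inner_zero_left orthonormal_on_inner zero_neq_one)
qed

text \<open>As many orthonormal vectors as the dimension span the whole space, so the residual
  \<open>y\<close> lies in their span and is orthogonal to itself.\<close>

lemma orthonormal_expansion:
  fixes e :: "'i \<Rightarrow> 'a::euclidean_space"
  assumes "orthonormal_on I e" "finite I" "card I = DIM('a)"
  shows "x = (\<Sum>i\<in>I. (x \<bullet> e i) *\<^sub>R e i)"
proof -
  define y where "y = x - (\<Sum>i\<in>I. (x \<bullet> e i) *\<^sub>R e i)"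
  have "card (e ` I) = DIM('a)"
    using assms by (simp add: card_image orthonormal_on_inj)
  then have "UNIV \<subseteq> span (e ` I)"
    by (intro card_ge_dim_independent orthonormal_on_independent[OF assms(1)])
      (simp_all add: dim_UNIV)
  then have "orthogonal y y"
    by (intro orthogonal_to_span[of y "e ` I"])
      (use orthonormal_on_residual[OF assms(1,2)] in \<open>auto simp: orthogonal_def y_def\<close>)
  then show ?thesis by (simp add: orthogonal_def y_def)
qed

lemma orthonormal_unit_exists:
  fixes e :: "'i \<Rightarrow> 'a::euclidean_space"
  assumes "finite I" "card I < DIM('a)"
  obtains x where "norm x = 1" "\<And>i. i \<in> I \<Longrightarrow> x \<bullet> e i = 0"
proof -
  have "dim (e ` I) < DIM('a)"
    using assms dim_le_card'[of "e ` I"] card_image_le[of I e] by simp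
  then obtain x where x: "x \<noteq> 0" "\<And>y. y \<in> span (e ` I) \<Longrightarrow> orthogonal x y"
    using orthogonal_to_subspace_exists[of "e ` I"] by metis
  have "x \<bullet> e i = 0" if "i \<in> I" for i
    using x(2)[of "e i"] that by (simp add: span_base orthogonal_def)
  then show thesis
    using that[of "x /\<^sub>R norm x"] x(1) by simp
qed

text \<open>Completes the right singular vectors to an eigenbasis of \<open>transpose X ** X\<close>
  when there are more columns than rows.\<close>

lemma orthonormal_on_extend:
  fixes e :: "nat \<Rightarrow> 'a::euclidean_space"
  assumes "orthonormal_on {1..k} e" "k \<le> n" "n \<le> DIM('a)"
  shows "\<exists>f. orthonormal_on {1..n} f \<and> (\<forall>i\<in>{1..k}. f i = e i)"
  using assms(2,3)
proof (induction n rule: dec_induct)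
  case base
  show ?case using assms(1) by blast
next
  case (step n)
  from step.IH step.prems obtain f
    where f: "orthonormal_on {1..n} f" "\<And>i. i \<in> {1..k} \<Longrightarrow> f i = e i"
    using Suc_leD by blast
  have "card {1..n} < DIM('a)" using step by simp
  then obtain x where x: "norm x = 1" "\<And>i. i \<in> {1..n} \<Longrightarrow> x \<bullet> f i = 0"
    using orthonormal_unit_exists[of "{1..n}"] by blast
  have "orthonormal_on (insert (Suc n) {1..n}) (f(Suc n := x))"
    by (rule orthonormal_on_insert) (use f x in auto)
  then show ?case
    using f(2) step(1)
    by (intro exI[of _ "f(Suc n := x)"] conjI ballI)
        (auto simp: atLeastAtMostSuc_conv simp del: fun_upd_apply, simp)
qed

subsection \<open>Existence of a singular value decomposition\<close>

text \<open>The unit spheres of the two orthogonal complements are compact, and nonempty because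
  \<open>I\<close> is smaller than both dimensions, so the continuous bilinear form attains its
  maximum on their product.\<close>

lemma unit_vectors_attain_bilinear_max:
  fixes X :: "real^'n^'m" and u :: "'i \<Rightarrow> real^'m" and v :: "'i \<Rightarrow> real^'n"
  assumes "finite I" "card I < CARD('m)" "card I < CARD('n)"
  obtains p q where "norm p = 1" "\<And>i. i \<in> I \<Longrightarrow> p \<bullet> u i = 0"
    "norm q = 1" "\<And>i. i \<in> I \<Longrightarrow> q \<bullet> v i = 0"
    "\<And>p' q'. norm p' = 1 \<Longrightarrow> (\<And>i. i \<in> I \<Longrightarrow> p' \<bullet> u i = 0) \<Longrightarrow> norm q' = 1 \<Longrightarrow>
       (\<And>i. i \<in> I \<Longrightarrow> q' \<bullet> v i = 0) \<Longrightarrow> p' \<bullet> (X *v q') \<le> p \<bullet> (X *v q)"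
proof -
  define P where "P = sphere 0 1 \<inter> (\<Inter>i\<in>I. {p. p \<bullet> u i = 0})"
  define Q where "Q = sphere 0 1 \<inter> (\<Inter>i\<in>I. {q. q \<bullet> v i = 0})"
  have cl: "closed {p. p \<bullet> w = 0}" for w :: "'b::euclidean_space"
    by (intro closed_Collect_eq continuous_intros)
  have "compact P" "compact Q"
    unfolding P_def Q_def by (auto intro!: compact_Int_closed closed_INT cl)
  then have "compact (P \<times> Q)" by (rule compact_Times)
  moreover have "P \<noteq> {}"
  proof -
    obtain x where "norm x = 1" "\<And>i. i \<in> I \<Longrightarrow> x \<bullet> u i = 0"
      using orthonormal_unit_exists[of I u] assms by auto
    then have "x \<in> P" by (simp add: P_def)
    then show ?thesis by blast
  qed
  moreover have "Q \<noteq> {}"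
  proof -
    obtain x where "norm x = 1" "\<And>i. i \<in> I \<Longrightarrow> x \<bullet> v i = 0"
      using orthonormal_unit_exists[of I v] assms by auto
    then have "x \<in> Q" by (simp add: Q_def)
    then show ?thesis by blast
  qed
  moreover have "continuous_on (P \<times> Q) (\<lambda>z. fst z \<bullet> (X *v snd z))"
    by (intro continuous_intros linear_continuous_on_compose[OF _ matrix_vector_mul_linear])
  ultimately obtain z where z: "z \<in> P \<times> Q"
    "\<And>y. y \<in> P \<times> Q \<Longrightarrow> fst y \<bullet> (X *v snd y) \<le> fst z \<bullet> (X *v snd z)"
    using continuous_attains_sup[of "P \<times> Q" "\<lambda>z. fst z \<bullet> (X *v snd z)"] by fast
  show thesis
  proof (rule that[of "fst z" "snd z"])
    fix p' q'
    assume "norm p' = 1" "\<And>i. i \<in> I \<Longrightarrow> p' \<bullet> u i = 0" "norm q' = 1" "\<And>i. i \<in> I \<Longrightarrow> q' \<bullet> v i = 0"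
    then show "p' \<bullet> (X *v q') \<le> fst z \<bullet> (X *v snd z)"
      using z(2)[of "(p', q')"] by (auto simp: P_def Q_def)
  qed (use z(1) in \<open>auto simp: P_def Q_def\<close>)
qed

text \<open>The equality case of Cauchy-Schwarz.\<close>

lemma eq_scaleR_if_inner_max:
  fixes p w :: "'a::real_inner"
  assumes "norm p = 1" "norm w \<le> p \<bullet> w"
  shows "w = (p \<bullet> w) *\<^sub>R p"
proof -
  have "(p \<bullet> w) \<le> norm w" using norm_cauchy_schwarz[of p w] assms(1) by simp
  then have eq: "p \<bullet> w = norm w" using assms(2) by simp
  then have "norm p *\<^sub>R w = norm w *\<^sub>R p"
    using norm_cauchy_schwarz_eq[of p w] assms(1) by simp
  then show ?thesis using eq assms(1) by simp
qed

text \<open>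
  The normalized image of \<open>q\<close> is itself a competitor for \<open>p\<close>, which forces equality in
  Cauchy--Schwarz.
\<close>

lemma bilinear_maximizer_is_singular_pair:
  fixes X :: "real^'n^'m"
  assumes "norm p = 1" "norm q = 1" "subspace S"
    and mem: "X *v q \<in> S"
    and max: "\<And>p'. norm p' = 1 \<Longrightarrow> p' \<in> S \<Longrightarrow> p' \<bullet> (X *v q) \<le> p \<bullet> (X *v q)"
    and "0 \<le> p \<bullet> (X *v q)"
  shows "X *v q = (p \<bullet> (X *v q)) *\<^sub>R p"
proof (rule eq_scaleR_if_inner_max[OF assms(1)])
  show "norm (X *v q) \<le> p \<bullet> (X *v q)"
  proof (cases "X *v q = 0")
    case False
    let ?w = "X *v q"
    have "(?w /\<^sub>R norm ?w) \<bullet> ?w \<le> p \<bullet> ?w"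
      using False by (intro max) (auto intro: subspace_scale assms mem)
    moreover have "(?w /\<^sub>R norm ?w) \<bullet> ?w = norm ?w"
      using False by (simp add: dot_square_norm power2_eq_square)
    ultimately show ?thesis by simp
  qed (use assms in simp)
qed

text \<open>One step of deflation: a pair maximizing \<open>p \<bullet> (X *v q)\<close> on the
  complements of the pairs found so far is again a singular pair, because \<open>X\<close> and
  \<open>transpose X\<close> carry these complements into each other.\<close>

lemma singular_vector_pair_exists:
  fixes X :: "real^'n^'m" and u :: "'i \<Rightarrow> real^'m" and v :: "'i \<Rightarrow> real^'n"
  assumes "finite I" "card I < CARD('m)" "card I < CARD('n)"
    and Xv: "\<And>i. i \<in> I \<Longrightarrow> X *v v i = s i *\<^sub>R u i"
    and uX: "\<And>i. i \<in> I \<Longrightarrow> transpose X *v u i = s i *\<^sub>R v i"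
  obtains p q t where "norm p = 1" "\<And>i. i \<in> I \<Longrightarrow> p \<bullet> u i = 0"
    "norm q = 1" "\<And>i. i \<in> I \<Longrightarrow> q \<bullet> v i = 0"
    "X *v q = t *\<^sub>R p" "transpose X *v p = t *\<^sub>R q" "0 \<le> t"
    "\<And>p' q'. norm p' = 1 \<Longrightarrow> (\<And>i. i \<in> I \<Longrightarrow> p' \<bullet> u i = 0) \<Longrightarrow> norm q' = 1 \<Longrightarrow>
       (\<And>i. i \<in> I \<Longrightarrow> q' \<bullet> v i = 0) \<Longrightarrow> p' \<bullet> (X *v q') \<le> t"
proof -
  have adj: "x \<bullet> (X *v y) = (transpose X *v x) \<bullet> y" for x y
    by (simp add: dot_lmul_matrix)
  obtain p q where pq: "norm p = 1" "\<And>i. i \<in> I \<Longrightarrow> p \<bullet> u i = 0"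
    "norm q = 1" "\<And>i. i \<in> I \<Longrightarrow> q \<bullet> v i = 0"
    and max: "\<And>p' q'. norm p' = 1 \<Longrightarrow> (\<And>i. i \<in> I \<Longrightarrow> p' \<bullet> u i = 0) \<Longrightarrow> norm q' = 1 \<Longrightarrow>
       (\<And>i. i \<in> I \<Longrightarrow> q' \<bullet> v i = 0) \<Longrightarrow> p' \<bullet> (X *v q') \<le> p \<bullet> (X *v q)"
    by (rule unit_vectors_attain_bilinear_max[OF assms(1-3), where X=X and u=u and v=v]) blast
  define t where "t = p \<bullet> (X *v q)"
  \<comment> \<open>\<open>- p\<close> is also admissible, so the maximum cannot be
    negative.\<close>
  have "(- p) \<bullet> (X *v q) \<le> t" unfolding t_def by (rule max) (use pq in auto)
  then have t: "0 \<le> t" by (simp add: t_def)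
  have sub: "subspace {x. \<forall>i\<in>I. x \<bullet> w i = 0}" for w :: "'i \<Rightarrow> 'b::real_inner"
    by (auto simp: subspace_def inner_add_left)
  have "X *v q = t *\<^sub>R p" unfolding t_def
  proof (rule bilinear_maximizer_is_singular_pair[OF pq(1,3) sub[of u]])
    \<comment> \<open>Moving \<open>X\<close> to the other side gives \<open>q \<bullet> (transpose
      X *v u i) = s i * (q \<bullet> v i) = 0\<close>.\<close>
    show "X *v q \<in> {x. \<forall>i\<in>I. x \<bullet> u i = 0}"
      using pq(4) uX by (auto simp: inner_commute[of "X *v q"] adj inner_commute)
    show "0 \<le> p \<bullet> (X *v q)" using t by (simp add: t_def)
    show "p' \<bullet> (X *v q) \<le> p \<bullet> (X *v q)" if "norm p' = 1" "p' \<in> {x. \<forall>i\<in>I. x \<bullet> u i = 0}" for p'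
      by (rule max) (use that pq in auto)
  qed
  moreover have "transpose X *v p = (q \<bullet> (transpose X *v p)) *\<^sub>R q"
  proof (rule bilinear_maximizer_is_singular_pair[OF pq(3,1) sub[of v]])
    show "transpose X *v p \<in> {x. \<forall>i\<in>I. x \<bullet> v i = 0}"
      using pq(2) Xv by (auto simp: adj[symmetric] simp del: transpose_matrix_vector)
    show "0 \<le> q \<bullet> (transpose X *v p)"
      using t by (simp add: t_def adj inner_commute)
    show "q' \<bullet> (transpose X *v p) \<le> q \<bullet> (transpose X *v p)"
      if "norm q' = 1" "q' \<in> {x. \<forall>i\<in>I. x \<bullet> v i = 0}" for q'
      using max[of p q'] that pq
      by (auto simp: inner_commute[of _ "transpose X *v p"] adj[symmetric]
          simp del: transpose_matrix_vector)
  qed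
  moreover have "q \<bullet> (transpose X *v p) = t"
    by (simp add: t_def adj inner_commute)
  ultimately show thesis
    using that[of p q t] pq t max by (simp add: t_def)
qed

definition singular_vectors ::
    "nat \<Rightarrow> real^'n^'m \<Rightarrow> (nat \<Rightarrow> real^'m) \<Rightarrow> (nat \<Rightarrow> real^'n) \<Rightarrow> (nat \<Rightarrow> real) \<Rightarrow> bool" where
  "singular_vectors k X u v s \<longleftrightarrow>
     orthonormal_on {1..k} u \<and> orthonormal_on {1..k} v \<and>
     (\<forall>i\<in>{1..k}. X *v v i = s i *\<^sub>R u i \<and> transpose X *v u i = s i *\<^sub>R v i) \<and>
     s \<in> ordered_nonneg k"

text \<open>The maximality clause strengthens the induction: applied to the next pair, it shows that
  the new value does not exceed the earlier ones, which keeps \<open>s\<close> ordered.\<close>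

lemma singular_vectors_exist_max:
  fixes X :: "real^'n^'m"
  assumes "k \<le> min CARD('m) CARD('n)"
  shows "\<exists>u v s. singular_vectors k X u v s \<and>
    (\<forall>i\<in>{1..k}. \<forall>p q. norm p = 1 \<longrightarrow> norm q = 1 \<longrightarrow> (\<forall>j\<in>{1..k}. p \<bullet> u j = 0) \<longrightarrow>
      (\<forall>j\<in>{1..k}. q \<bullet> v j = 0) \<longrightarrow> p \<bullet> (X *v q) \<le> s i)"
  using assms
proof (induction k)
  case 0
  show ?case by (auto simp: singular_vectors_def orthonormal_on_def ordered_nonneg_def)
next
  case (Suc k)
  then obtain u v s where sv: "singular_vectors k X u v s"
    and max: "\<And>i p q. i \<in> {1..k} \<Longrightarrow> norm p = 1 \<Longrightarrow> norm q = 1 \<Longrightarrow> \<forall>j\<in>{1..k}. p \<bullet> u j = 0 \<Longrightarrow>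
      \<forall>j\<in>{1..k}. q \<bullet> v j = 0 \<Longrightarrow> p \<bullet> (X *v q) \<le> s i"
    using Suc_leD by blast
  have fin: "finite {1..k}" "card {1..k} < CARD('m)" "card {1..k} < CARD('n)"
    using Suc.prems by auto
  have Xv: "\<And>i. i \<in> {1..k} \<Longrightarrow> X *v v i = s i *\<^sub>R u i"
    and uX: "\<And>i. i \<in> {1..k} \<Longrightarrow> transpose X *v u i = s i *\<^sub>R v i"
    and s: "s \<in> ordered_nonneg k"
    and on: "orthonormal_on {1..k} u" "orthonormal_on {1..k} v"
    using sv by (auto simp: singular_vectors_def)
  obtain p q t where pq: "norm p = 1" "\<And>i. i \<in> {1..k} \<Longrightarrow> p \<bullet> u i = 0"
    "norm q = 1" "\<And>i. i \<in> {1..k} \<Longrightarrow> q \<bullet> v i = 0"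
    "X *v q = t *\<^sub>R p" "transpose X *v p = t *\<^sub>R q" "0 \<le> t"
    and max': "\<And>p' q'. norm p' = 1 \<Longrightarrow> (\<And>i. i \<in> {1..k} \<Longrightarrow> p' \<bullet> u i = 0) \<Longrightarrow> norm q' = 1 \<Longrightarrow>
       (\<And>i. i \<in> {1..k} \<Longrightarrow> q' \<bullet> v i = 0) \<Longrightarrow> p' \<bullet> (X *v q') \<le> t"
    by (rule singular_vector_pair_exists[OF fin Xv uX]) blast+
  have le: "t \<le> s i" if "i \<in> {1..k}" for i
    using max[OF that pq(1,3)] pq by (simp add: norm_eq_1)
  let ?u = "u(Suc k := p)" and ?v = "v(Suc k := q)" and ?s = "s(Suc k := t)"
  have ins: "{1..Suc k} = insert (Suc k) {1..k}" by auto
  have "orthonormal_on {1..Suc k} ?u" "orthonormal_on {1..Suc k} ?v"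
    unfolding ins using on pq by (auto intro!: orthonormal_on_insert)
  moreover have "?s \<in> ordered_nonneg (Suc k)"
    using s le pq(7) by (auto simp: ordered_nonneg_def le_Suc_eq)
  ultimately have "singular_vectors (Suc k) X ?u ?v ?s"
    using Xv uX pq unfolding singular_vectors_def by (auto simp: le_Suc_eq)
  moreover have "p' \<bullet> (X *v q') \<le> ?s i"
    if "i \<in> {1..Suc k}" "norm p' = 1" "norm q' = 1" "\<forall>j\<in>{1..Suc k}. p' \<bullet> ?u j = 0"
      "\<forall>j\<in>{1..Suc k}. q' \<bullet> ?v j = 0" for i p' q'
  proof -
    \<comment> \<open>Orthogonality to the first \<open>k\<close> pairs already gives the bound
      \<open>t\<close>, and \<open>t\<close> is the smallest of the values
      \<open>?s i\<close>.\<close>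
    have "p' \<bullet> (X *v q') \<le> t"
    proof (rule max'[OF that(2) _ that(3)])
      show "p' \<bullet> u i = 0" if "i \<in> {1..k}" for i
        using that \<open>\<forall>j\<in>{1..Suc k}. p' \<bullet> ?u j = 0\<close> by (auto dest!: bspec[of _ _ i])
      show "q' \<bullet> v i = 0" if "i \<in> {1..k}" for i
        using that \<open>\<forall>j\<in>{1..Suc k}. q' \<bullet> ?v j = 0\<close> by (auto dest!: bspec[of _ _ i])
    qed
    also have "t \<le> ?s i" using le that(1) by (auto simp: le_Suc_eq)
    finally show ?thesis .
  qed
  ultimately show ?case by blast
qed

section \<open>Rank-one matrices and the singular value decomposition\<close>

definition outer :: "real^'m \<Rightarrow> real^'n \<Rightarrow> real^'n^'m" where
  "outer u v = (\<chi> i j. u $ i * v $ j)"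

lemma inner_outer: "outer u v \<bullet> outer p q = (u \<bullet> p) * (v \<bullet> q)"
proof -
  have "outer u v \<bullet> outer p q = (\<Sum>i\<in>UNIV. \<Sum>j\<in>UNIV. (u $ i * p $ i) * (v $ j * q $ j))"
    by (simp add: outer_def inner_vec_def algebra_simps)
  then show ?thesis by (simp add: inner_vec_def sum_product)
qed

lemma outer_mult_vec: "outer u v *v x = (v \<bullet> x) *\<^sub>R u"
  by (simp add: outer_def matrix_vector_mult_def inner_vec_def vec_eq_iff sum_distrib_left
      sum_distrib_right algebra_simps)

lemma transpose_outer: "transpose (outer u v) = outer v u"
  by (simp add: outer_def transpose_def vec_eq_iff)

lemma sum_matrix_vector_mult:
  "(\<Sum>i\<in>I. M i :: real^'n^'m) *v x = (\<Sum>i\<in>I. M i *v x)"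
  by (induction I rule: infinite_finite_induct) (auto simp: matrix_vector_mult_add_rdistrib)

lemma scaleR_transpose_sum:
  "transpose (\<Sum>i\<in>I. c i *\<^sub>R (M i :: real^'n^'m)) = (\<Sum>i\<in>I. c i *\<^sub>R transpose (M i))"
  by (simp add: vec_eq_iff transpose_def)

text \<open>The thin decomposition: both families have \<open>min CARD('m) CARD('n)\<close> members,
  so in general only the one on the smaller side is a basis.\<close>

definition svd :: "real^'n^'m \<Rightarrow> (nat \<Rightarrow> real^'m) \<Rightarrow> (nat \<Rightarrow> real^'n) \<Rightarrow> (nat \<Rightarrow> real) \<Rightarrow> bool" where
  "svd X u v s \<longleftrightarrow>
     orthonormal_on {1..min CARD('m) CARD('n)} u \<and> orthonormal_on {1..min CARD('m) CARD('n)} v \<and>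
     s \<in> ordered_nonneg (min CARD('m) CARD('n)) \<and>
     X = (\<Sum>i=1..min CARD('m) CARD('n). s i *\<^sub>R outer (u i) (v i))"

text \<open>The family on the smaller side is an orthonormal basis. If it is \<open>v\<close>,
  expand \<open>x\<close> in it before applying \<open>X\<close>; if it is \<open>u\<close>, expand
  the image \<open>X *v x\<close> and move \<open>X\<close> across the inner product.\<close>

theorem svd_exists:
  fixes X :: "real^'n^'m"
  obtains u v s where "svd X u v s"
proof -
  let ?k = "min CARD('m) CARD('n)"
  obtain u v s where "singular_vectors ?k X u v s"
    using singular_vectors_exist_max[of ?k X] by blast
  then have on: "orthonormal_on {1..?k} u" "orthonormal_on {1..?k} v" "s \<in> ordered_nonneg ?k"
    and X: "\<And>i. i \<in> {1..?k} \<Longrightarrow> X *v v i = s i *\<^sub>R u i"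
      "\<And>i. i \<in> {1..?k} \<Longrightarrow> transpose X *v u i = s i *\<^sub>R v i"
    by (auto simp: singular_vectors_def)
  define Y where "Y = (\<Sum>i=1..?k. s i *\<^sub>R outer (u i) (v i))"
  have "X *v x = Y *v x" for x
  proof (cases "CARD('n) \<le> CARD('m)")
    case True
    have "X *v x = X *v (\<Sum>i=1..?k. (x \<bullet> v i) *\<^sub>R v i)"
      by (subst orthonormal_expansion[OF on(2), of x]) (use True in auto)
    also have "\<dots> = (\<Sum>i=1..?k. (x \<bullet> v i) *\<^sub>R (X *v v i))"
      by (simp add: linear_sum[OF matrix_vector_mul_linear] matrix_vector_mult_scaleR)
    also have "\<dots> = Y *v x"
      by (auto simp: Y_def sum_matrix_vector_mult scaleR_matrix_vector_assoc[symmetric]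
          outer_mult_vec X inner_commute mult.commute intro!: sum.cong)
    finally show ?thesis .
  next
    case False
    have "X *v x = (\<Sum>i=1..?k. ((X *v x) \<bullet> u i) *\<^sub>R u i)"
      by (rule orthonormal_expansion[OF on(1)]) (use False in auto)
    also have "\<dots> = (\<Sum>i=1..?k. ((transpose X *v u i) \<bullet> x) *\<^sub>R u i)"
      by (simp add: dot_lmul_matrix inner_commute[of "X *v x"])
    also have "\<dots> = Y *v x"
      by (auto simp: Y_def sum_matrix_vector_mult scaleR_matrix_vector_assoc[symmetric]
          outer_mult_vec X inner_commute mult.commute simp del: transpose_matrix_vector
          intro!: sum.cong)
    finally show ?thesis .
  qed
  then have "X = Y" by (simp add: matrix_eq)
  then show thesis
    using that[of u v s] on by (simp add: svd_def Y_def)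
qed

subsection \<open>Singular values as square roots of eigenvalues\<close>

lemma poly_charpoly: "poly (charpoly A) t = det (mat t - A)"
proof -
  have "poly (charpoly A) t = (\<Sum>p\<in>{p. p permutes UNIV}. of_int (sign p) *
      (\<Prod>i\<in>UNIV. poly ((if i = p i then [:0, 1:] else 0) - [:A $ i $ p i:]) t))"
    by (simp add: charpoly_def det_def poly_sum poly_prod)
  also have "\<dots> = det (mat t - A)"
    unfolding det_def
    by (intro sum.cong prod.cong arg_cong2[where f="(*)"] refl) (simp_all add: mat_def)
  finally show ?thesis .
qed

text \<open>With the eigenvectors as columns of \<open>P\<close>,
  \<open>(mat t - A) ** P = P ** D\<close> for a diagonal \<open>D\<close>. Cancelling
  \<open>det P\<close> gives the factorization at every real \<open>t\<close>, hence as
  polynomials.\<close>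

lemma charpoly_orthonormal_eigenbasis:
  fixes A :: "real^'n^'n"
  assumes on: "orthonormal_on {1..CARD('n)} e"
    and eig: "\<And>i. i \<in> {1..CARD('n)} \<Longrightarrow> A *v e i = d i *\<^sub>R e i"
  shows "charpoly A = (\<Prod>i=1..CARD('n). [:- d i, 1:])"
proof -
  \<comment> \<open>\<open>f\<close> translates between the matrix index type and the numbering of
    the eigenvectors from 1.\<close>
  obtain f where f: "bij_betw f (UNIV :: 'n set) {1..CARD('n)}"
    using finite_same_card_bij[of "UNIV :: 'n set" "{1..CARD('n)}"] by auto
  then have mem: "f c \<in> {1..CARD('n)}" for c by (auto simp: bij_betw_def)
  have inj: "f c = f c' \<longleftrightarrow> c = c'" for c c' using f by (auto simp: bij_betw_def inj_on_def)
  define P :: "real^'n^'n" where "P = (\<chi> r c. e (f c) $ r)"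
  have "transpose P ** P = mat 1"
  proof -
    have "(transpose P ** P) $ r $ c = e (f r) \<bullet> e (f c)" for r c
      by (simp add: P_def matrix_matrix_mult_def transpose_def inner_vec_def)
    then show ?thesis
      using orthonormal_on_inner[OF on mem mem] by (simp add: vec_eq_iff mat_def inj)
  qed
  then have "det (transpose P ** P) = 1" by simp
  then have P: "det P \<noteq> 0" by (auto simp: det_mul)
  have "poly (charpoly A) t = poly (\<Prod>i=1..CARD('n). [:- d i, 1:]) t" for t
  proof -
    define D :: "real^'n^'n" where "D = (\<chi> r c. if r = c then t - d (f r) else 0)"
    have "((mat t - A) ** P) $ r $ c = (P ** D) $ r $ c" for r c
    proof -
      have "((mat t - A) ** P) $ r $ c = ((mat t - A) *v e (f c)) $ r"
        by (simp add: matrix_matrix_mult_def matrix_vector_mult_def P_def)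
      also have "\<dots> = (t - d (f c)) * e (f c) $ r"
      proof -
        have "(mat t *v e (f c)) $ r = t * e (f c) $ r"
          by (simp add: matrix_vector_mult_def mat_def if_distribR cong: if_cong)
            (simp add: mult_delta_left)
        then show ?thesis
          by (simp add: matrix_vector_mult_diff_rdistrib eig[OF mem] algebra_simps)
      qed
      also have "\<dots> = (P ** D) $ r $ c"
        by (simp add: matrix_matrix_mult_def P_def D_def mult_delta_right mult.commute)
      finally show ?thesis .
    qed
    then have "(mat t - A) ** P = P ** D" by (simp add: vec_eq_iff)
    from arg_cong[OF this, of det] have "det (mat t - A) * det P = det P * det D"
      by (simp add: det_mul)
    then have "det (mat t - A) = det D" using P by simp
    also have "\<dots> = (\<Prod>c\<in>UNIV. t - d (f c))"
      by (subst det_diagonal) (auto simp: D_def)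
    also have "\<dots> = (\<Prod>i=1..CARD('n). t - d i)"
      by (rule prod.reindex_bij_betw[OF f])
    finally show ?thesis by (simp add: poly_charpoly poly_prod)
  qed
  then show ?thesis by (simp add: poly_eq_poly_eq_iff[symmetric] fun_eq_iff)
qed

lemma svd_mult_vec:
  fixes X :: "real^'n^'m"
  assumes "svd X u v s"
  shows "X *v x = (\<Sum>i=1..min CARD('m) CARD('n). (s i * (v i \<bullet> x)) *\<^sub>R u i)"
proof -
  have "X = (\<Sum>i=1..min CARD('m) CARD('n). s i *\<^sub>R outer (u i) (v i))"
    using assms by (simp add: svd_def)
  from arg_cong[OF this, of "\<lambda>M. M *v x"] show ?thesis
    by (simp add: sum_matrix_vector_mult scaleR_matrix_vector_assoc[symmetric] outer_mult_vec)
qed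

lemma svd_transpose:
  fixes X :: "real^'n^'m"
  assumes "svd X u v s"
  shows "svd (transpose X) v u s"
proof -
  have "X = (\<Sum>i=1..min CARD('m) CARD('n). s i *\<^sub>R outer (u i) (v i))"
    using assms by (simp add: svd_def)
  from arg_cong[OF this, of transpose]
  have "transpose X = (\<Sum>i=1..min CARD('m) CARD('n). s i *\<^sub>R outer (v i) (u i))"
    by (simp add: scaleR_transpose_sum transpose_outer)
  then show ?thesis
    using assms by (simp add: svd_def min.commute)
qed

lemma svd_mult_right_vector:
  fixes X :: "real^'n^'m"
  assumes "svd X u v s" "j \<in> {1..min CARD('m) CARD('n)}"
  shows "X *v v j = s j *\<^sub>R u j"
proof -
  have on: "orthonormal_on {1..min CARD('m) CARD('n)} v"
    using assms by (simp add: svd_def)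
  have "X *v v j = (\<Sum>i=1..min CARD('m) CARD('n). if i = j then s i *\<^sub>R u i else 0)"
    unfolding svd_mult_vec[OF assms(1)]
    by (rule sum.cong) (use orthonormal_on_inner[OF on _ assms(2)] in auto)
  then show ?thesis using assms(2) by simp
qed

lemma sum_singleton_mset: "(\<Sum>i\<in>A. {#f i#}) = image_mset f (mset_set A)"
  by (induction A rule: infinite_finite_induct) auto

text \<open>The completed right singular vectors diagonalize \<open>transpose X ** X\<close>, which
  determines the roots of its characteristic polynomial. So any decomposition yields the singular
  values defined through these roots, already in the right order.\<close>

lemma singular_value_eq:
  fixes X :: "real^'n^'m"
  assumes "svd X u v s" "i \<in> {1..min CARD('m) CARD('n)}"
  shows "singular_value i X = s i"
proof -
  let ?k = "min CARD('m) CARD('n)" and ?N = "CARD('n)"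
  have on: "orthonormal_on {1..?k} v" and s: "s \<in> ordered_nonneg ?k"
    using assms by (auto simp: svd_def)
  obtain w where w: "orthonormal_on {1..?N} w" "\<And>j. j \<in> {1..?k} \<Longrightarrow> w j = v j"
    using orthonormal_on_extend[OF on, of ?N] by auto
  \<comment> \<open>Padding by zeros: the added vectors lie in the kernel of \<open>X\<close> and
    contribute the remaining eigenvalues 0.\<close>
  define s' where "s' j = (if j \<le> ?k then s j else 0)" for j
  have "(transpose X ** X) *v w j = (s' j)\<^sup>2 *\<^sub>R w j" if j: "j \<in> {1..?N}" for j
  proof (cases "j \<le> ?k")
    case True
    then have jk: "j \<in> {1..?k}" using j by auto
    then have jk': "j \<in> {1..min CARD('n) CARD('m)}" by auto
    have "(transpose X ** X) *v w j = transpose X *v (X *v v j)"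
      by (simp add: matrix_vector_mul_assoc[symmetric] w(2)[OF jk])
    also have "\<dots> = (s j)\<^sup>2 *\<^sub>R v j"
      using svd_mult_right_vector[OF assms(1) jk]
        svd_mult_right_vector[OF svd_transpose[OF assms(1)] jk']
      by (simp add: matrix_vector_mult_scaleR power2_eq_square del: transpose_matrix_vector)
    finally show ?thesis using True jk w(2) by (simp add: s'_def)
  next
    case False
    have "v l \<bullet> w j = 0" if "l \<in> {1..?k}" for l
      using orthonormal_on_inner[OF w(1), of l j] w(2)[OF that] that False j by auto
    then have "X *v w j = 0"
      unfolding svd_mult_vec[OF assms(1)] by (intro sum.neutral) simp
    then show ?thesis
      using False j by (simp add: matrix_vector_mul_assoc[symmetric] s'_def
          del: transpose_matrix_vector)
  qed
  then have cp: "charpoly (transpose X ** X) = (\<Prod>j=1..?N. [:- ((s' j)\<^sup>2), 1:])"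
    by (rule charpoly_orthonormal_eigenbasis[OF w(1)])
  have s'_nonneg: "0 \<le> s' j" if "j \<in> {1..?N}" for j
    using s that by (auto simp: s'_def ordered_nonneg_def)
  have "proots (charpoly (transpose X ** X)) = image_mset (\<lambda>j. (s' j)\<^sup>2) (mset_set {1..?N})"
    unfolding cp by (subst proots_prod) (auto simp: sum_singleton_mset)
  then have "image_mset sqrt (proots (charpoly (transpose X ** X))) =
      image_mset (\<lambda>j. sqrt ((s' j)\<^sup>2)) (mset_set {1..?N})"
    by (simp add: multiset.map_comp o_def)
  also have "\<dots> = image_mset s' (mset_set {1..?N})"
    by (rule image_mset_cong) (use s'_nonneg in auto)
  also have "\<dots> = mset (map s' [1..<Suc ?N])"
    by (simp add: mset_upt atLeastLessThanSuc_atLeastAtMost del: upt_Suc)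
  finally have "image_mset sqrt (proots (charpoly (transpose X ** X))) = mset (map s' [1..<Suc ?N])" .
  then have "singular_value_list X = rev (sort (map s' [1..<Suc ?N]))"
    by (simp only: singular_value_list_def sorted_list_of_multiset_mset)
  \<comment> \<open>\<open>s'\<close> is non-increasing, so sorting reverses its list, and the
    \<open>rev\<close> in \<open>singular_value_list\<close> restores it.\<close>
  also have "sort (map s' [1..<Suc ?N]) = rev (map s' [1..<Suc ?N])"
  proof (rule properties_for_sort)
    have "s' c \<le> s' b" if "b \<in> {1..?N}" "c \<in> {1..?N}" "b \<le> c" for b c
      using s that by (auto simp: s'_def ordered_nonneg_def)
    then show "sorted (rev (map s' [1..<Suc ?N]))"
      unfolding sorted_wrt_rev sorted_wrt_map
      by (intro sorted_wrt_mono_rel[OF _ sorted_wrt_upt]) auto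
  qed simp
  finally have "singular_value_list X = map s' [1..<Suc ?N]"
    by (simp del: upt_Suc)
  moreover have "map s' [1..<Suc ?N] ! (i - 1) = s' i"
    by (subst nth_map) (use assms(2) in \<open>auto simp del: upt_Suc\<close>)
  ultimately show ?thesis
    using assms(2) by (simp add: singular_value_def s'_def)
qed

subsection \<open>Von Neumann's trace inequality\<close>

text \<open>Summation by parts as an induction: since the partial sum is nonnegative, replacing its
  factor \<open>t k\<close> by the smaller \<open>t (Suc k)\<close> can only decrease the
  product.\<close>

lemma Abel_sum_le:
  assumes "t \<in> ordered_nonneg k" "\<And>q. q \<le> k \<Longrightarrow> 0 \<le> (\<Sum>j=1..q. d j)"
  shows "t k * (\<Sum>j=1..k. d j) \<le> (\<Sum>j=1..k. t j * d j)"
  using assms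
proof (induction k)
  case (Suc k)
  have IH: "t k * (\<Sum>j=1..k. d j) \<le> (\<Sum>j=1..k. t j * d j)"
    using Suc.prems by (intro Suc.IH) (auto simp: ordered_nonneg_def)
  have "t (Suc k) * (\<Sum>j=1..k. d j) \<le> t k * (\<Sum>j=1..k. d j)"
  proof (cases "k = 0")
    case False
    then have "t (Suc k) \<le> t k" using Suc.prems(1) by (auto simp: ordered_nonneg_def)
    then show ?thesis using Suc.prems(2)[of k] by (intro mult_right_mono) auto
  qed simp
  then show ?case using IH by (simp add: distrib_left)
qed simp

lemma ordered_sum_mono_partial_sums:
  assumes "t \<in> ordered_nonneg k" "\<And>q. q \<le> k \<Longrightarrow> (\<Sum>j=1..q. w j) \<le> (\<Sum>j=1..q. w' j)"
  shows "(\<Sum>j=1..k. t j * w j) \<le> (\<Sum>j=1..k. t j * w' j)"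
proof -
  have "0 \<le> t k * (\<Sum>j=1..k. w' j - w j)"
    using assms by (cases "k = 0") (auto simp: sum_subtractf ordered_nonneg_def)
  also have "\<dots> \<le> (\<Sum>j=1..k. t j * (w' j - w j))"
    using assms by (intro Abel_sum_le) (auto simp: sum_subtractf)
  finally show ?thesis by (simp add: right_diff_distrib sum_subtractf)
qed

text \<open>The partial sum comparison is used twice: with weights \<open>t\<close> it reduces the
  claim to the sums over \<open>j \<le> q\<close>, and with weights \<open>s\<close> it reduces
  these to the sums of \<open>M\<close> over rectangular corners.\<close>

lemma substochastic_bilinear_le:
  fixes M :: "nat \<Rightarrow> nat \<Rightarrow> real"
  assumes s: "s \<in> ordered_nonneg k" and t: "t \<in> ordered_nonneg k"
    and M: "\<And>i j. 0 \<le> M i j"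
    and row: "\<And>i. i \<in> {1..k} \<Longrightarrow> (\<Sum>j=1..k. M i j) \<le> 1"
    and col: "\<And>j. j \<in> {1..k} \<Longrightarrow> (\<Sum>i=1..k. M i j) \<le> 1"
  shows "(\<Sum>i=1..k. \<Sum>j=1..k. s i * t j * M i j) \<le> (\<Sum>i=1..k. s i * t i)"
proof -
  have "(\<Sum>j=1..q. \<Sum>i=1..k. s i * M i j) \<le> (\<Sum>j=1..q. s j)" if q: "q \<le> k" for q
  proof -
    have "(\<Sum>j=1..q. \<Sum>i=1..k. s i * M i j) = (\<Sum>i=1..k. s i * (\<Sum>j=1..q. M i j))"
      by (subst sum.swap) (simp add: sum_distrib_left)
    \<comment> \<open>The corner of \<open>p\<close> rows and \<open>q\<close> columns has total at
      most \<open>p\<close> by the row sums and at most \<open>q\<close> by the column sums, and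
      \<open>min p q\<close> is the partial sum of the indicator of
      \<open>i \<le> q\<close>.\<close>
    also have "\<dots> \<le> (\<Sum>i=1..k. s i * (if i \<le> q then 1 else 0))"
    proof (rule ordered_sum_mono_partial_sums[OF s])
      fix p assume p: "p \<le> k"
      have "(\<Sum>j=1..q. M i j) \<le> 1" if "i \<in> {1..p}" for i
        using row[of i] that p q sum_mono2[of "{1..k}" "{1..q}" "M i"] M by force
      then have "(\<Sum>i=1..p. \<Sum>j=1..q. M i j) \<le> (\<Sum>i=1..p. 1)"
        by (rule sum_mono)
      moreover have "(\<Sum>i=1..p. M i j) \<le> 1" if "j \<in> {1..q}" for j
        using col[of j] that p q sum_mono2[of "{1..k}" "{1..p}" "\<lambda>i. M i j"] M by force
      then have "(\<Sum>j=1..q. \<Sum>i=1..p. M i j) \<le> (\<Sum>j=1..q. 1)"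
        by (rule sum_mono)
      moreover have "{1..p} \<inter> {i. i \<le> q} = {1..min p q}" by auto
      ultimately show "(\<Sum>i=1..p. \<Sum>j=1..q. M i j) \<le> (\<Sum>i=1..p. if i \<le> q then 1 else 0)"
        by (subst (asm) (2) sum.swap) (simp add: sum.If_cases)
    qed
    also have "\<dots> = (\<Sum>j=1..q. s j)"
    proof -
      have "{1..k} \<inter> {i. i \<le> q} = {1..q}" using q by auto
      then show ?thesis by (simp add: if_distrib sum.If_cases cong: if_cong)
    qed
    finally show ?thesis .
  qed
  then have "(\<Sum>j=1..k. t j * (\<Sum>i=1..k. s i * M i j)) \<le> (\<Sum>j=1..k. t j * s j)"
    by (rule ordered_sum_mono_partial_sums[OF t])
  moreover have "(\<Sum>i=1..k. \<Sum>j=1..k. s i * t j * M i j) = (\<Sum>j=1..k. t j * (\<Sum>i=1..k. s i * M i j))"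
    by (subst sum.swap) (simp add: sum_distrib_left mult_ac)
  ultimately show ?thesis by (simp add: mult.commute)
qed

lemma von_Neumann_trace_svd:
  fixes X Y :: "real^'n^'m"
  assumes X: "svd X u v s" and Y: "svd Y p q t"
  shows "X \<bullet> Y \<le> (\<Sum>i=1..min CARD('m) CARD('n). s i * t i)"
proof -
  let ?k = "min CARD('m) CARD('n)"
  note X' = X[unfolded svd_def] and Y' = Y[unfolded svd_def]
  have nn: "0 \<le> s i" "0 \<le> t i" if "i \<in> {1..?k}" for i
    using X' Y' that by (auto simp: ordered_nonneg_def)
  have unit: "\<And>i. i \<in> {1..?k} \<Longrightarrow> u i \<bullet> u i = 1" "\<And>i. i \<in> {1..?k} \<Longrightarrow> v i \<bullet> v i = 1"
    "\<And>i. i \<in> {1..?k} \<Longrightarrow> p i \<bullet> p i = 1" "\<And>i. i \<in> {1..?k} \<Longrightarrow> q i \<bullet> q i = 1"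
    using X' Y' by (simp_all add: orthonormal_on_def)
  define M where "M i j = ((u i \<bullet> p j)\<^sup>2 + (v i \<bullet> q j)\<^sup>2) / 2" for i j
  \<comment> \<open>AM-GM majorizes the coefficients by a matrix that is doubly substochastic by Bessel.\<close>
  have "X \<bullet> Y = (\<Sum>i=1..?k. s i *\<^sub>R outer (u i) (v i)) \<bullet> (\<Sum>j=1..?k. t j *\<^sub>R outer (p j) (q j))"
    using X' Y' by (intro arg_cong2[where f="(\<bullet>)"]) blast+
  also have "\<dots> = (\<Sum>i=1..?k. \<Sum>j=1..?k. s i * t j * ((u i \<bullet> p j) * (v i \<bullet> q j)))"
    by (simp add: inner_sum_left inner_sum_right inner_outer sum_distrib_left mult_ac)
      (subst sum.swap, rule refl)
  also have "\<dots> \<le> (\<Sum>i=1..?k. \<Sum>j=1..?k. s i * t j * M i j)"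
  proof (intro sum_mono mult_left_mono)
    show "(u i \<bullet> p j) * (v i \<bullet> q j) \<le> M i j" for i j
      using sum_squares_bound[of "u i \<bullet> p j" "v i \<bullet> q j"] by (simp add: M_def)
  qed (simp add: nn)
  also have "\<dots> \<le> (\<Sum>i=1..?k. s i * t i)"
  proof (rule substochastic_bilinear_le)
    show "(\<Sum>j=1..?k. M i j) \<le> 1" if "i \<in> {1..?k}" for i
      using Bessel_inequality[of "{1..?k}" p "u i"] Bessel_inequality[of "{1..?k}" q "v i"]
        Y' unit(1,2)[OF that]
      by (simp add: M_def sum.distrib flip: sum_divide_distrib)
    show "(\<Sum>i=1..?k. M i j) \<le> 1" if "j \<in> {1..?k}" for j
      using Bessel_inequality[of "{1..?k}" u "p j"] Bessel_inequality[of "{1..?k}" v "q j"]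
        X' unit(3,4)[OF that]
      by (simp add: M_def sum.distrib inner_commute[of "u _" "p j"] inner_commute[of "v _" "q j"]
          flip: sum_divide_distrib)
  qed (use X' Y' in \<open>auto simp: M_def\<close>)
  finally show ?thesis .
qed

text \<open>Orthonormality removes the cross terms. This is the equality case of the trace
  inequality and, for \<open>X = Y\<close>, the formula for the Frobenius norm.\<close>

lemma inner_same_singular_vectors:
  fixes X Y :: "real^'n^'m"
  assumes "svd X u v s" "svd Y u v t"
  shows "X \<bullet> Y = (\<Sum>i=1..min CARD('m) CARD('n). s i * t i)"
proof -
  let ?k = "min CARD('m) CARD('n)"
  note X = assms(1)[unfolded svd_def] and Y = assms(2)[unfolded svd_def]
  have "X \<bullet> Y = (\<Sum>i=1..?k. s i *\<^sub>R outer (u i) (v i)) \<bullet> (\<Sum>j=1..?k. t j *\<^sub>R outer (u j) (v j))"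
    using X Y by (intro arg_cong2[where f="(\<bullet>)"]) blast+
  also have "\<dots> = (\<Sum>i=1..?k. \<Sum>j=1..?k. s i * t j * ((u i \<bullet> u j) * (v i \<bullet> v j)))"
    by (simp add: inner_sum_left inner_sum_right inner_outer sum_distrib_left mult_ac)
      (subst sum.swap, rule refl)
  also have "\<dots> = (\<Sum>i=1..?k. \<Sum>j=1..?k. if i = j then s i * t j else 0)"
    using X by (intro sum.cong refl) (auto simp: orthonormal_on_inner)
  finally show ?thesis by simp
qed

lemma singular_values_ordered_nonneg:
  fixes X :: "real^'n^'m"
  shows "(\<lambda>i. singular_value i X) \<in> ordered_nonneg (min CARD('m) CARD('n))"
proof -
  obtain u v s where "svd X u v s" by (rule svd_exists)
  then show ?thesis
    by (auto simp: ordered_nonneg_def singular_value_eq svd_def)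
qed

theorem von_Neumann_trace_inequality:
  fixes X Y :: "real^'n^'m"
  shows "X \<bullet> Y \<le> (\<Sum>i=1..min CARD('m) CARD('n). singular_value i X * singular_value i Y)"
proof -
  obtain u v s where X: "svd X u v s" by (rule svd_exists)
  obtain p q t where Y: "svd Y p q t" by (rule svd_exists)
  show ?thesis
    using von_Neumann_trace_svd[OF X Y] by (simp add: singular_value_eq[OF X] singular_value_eq[OF Y])
qed

lemma norm_sq_eq_sum_singular_values:
  fixes X :: "real^'n^'m"
  shows "(norm X)\<^sup>2 = (\<Sum>i=1..min CARD('m) CARD('n). (singular_value i X)\<^sup>2)"
proof -
  obtain u v s where X: "svd X u v s" by (rule svd_exists)
  show ?thesis
    using inner_same_singular_vectors[OF X X]
    by (simp add: singular_value_eq[OF X] power2_norm_eq_inner)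
      (simp add: power2_eq_square)
qed

text \<open>\<open>Y\<close> carries the prescribed values \<open>t\<close> on the singular vectors
  of \<open>X\<close>. This is the passage from ordered vectors back to matrices.\<close>

lemma trace_inequality_sharp:
  fixes X :: "real^'n^'m"
  assumes "t \<in> ordered_nonneg (min CARD('m) CARD('n))"
  obtains Y :: "real^'n^'m" where
    "\<And>i. i \<in> {1..min CARD('m) CARD('n)} \<Longrightarrow> singular_value i Y = t i"
    "X \<bullet> Y = (\<Sum>i=1..min CARD('m) CARD('n). singular_value i X * t i)"
proof -
  obtain u v s where X: "svd X u v s" by (rule svd_exists)
  define Y where "Y = (\<Sum>i=1..min CARD('m) CARD('n). t i *\<^sub>R outer (u i) (v i))"
  have Y: "svd Y u v t" using X assms by (simp add: svd_def Y_def)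
  show thesis
    using that[of Y] inner_same_singular_vectors[OF X Y] singular_value_eq[OF Y]
    by (simp add: singular_value_eq[OF X])
qed

subsection \<open>The conjugate and the biconjugate\<close>

text \<open>Equal to \<open>max 0 ((pos_part (z - \<alpha>))\<^sup>2 - \<beta>)\<close>. For
  \<alpha> = \<open>a i\<close> and \<beta> = \<open>b i\<close> it is the supremum over
  \<open>x \<ge> 0\<close> of \<open>2 * z * x - x\<^sup>2 - h a b i x\<close>: the first entry
  comes from \<open>x = 0\<close>, the second from \<open>x > 0\<close>.\<close>

definition h_conj :: "real \<Rightarrow> real \<Rightarrow> real \<Rightarrow> real" where
  "h_conj \<alpha> \<beta> z = (pos_part (z - \<alpha>))\<^sup>2 - min \<beta> ((pos_part (z - \<alpha>))\<^sup>2)"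

lemma h_conj_upper:
  assumes "0 \<le> x"
  shows "2 * z * x - x\<^sup>2 - h a b i x \<le> h_conj (a i) (b i) z"
proof (cases "x = 0")
  case True
  then show ?thesis by (simp add: h_def h_conj_def)
next
  case False
  have "2 * (z - a i) * x - x\<^sup>2 \<le> (pos_part (z - a i))\<^sup>2"
  proof (cases "a i \<le> z")
    case True
    have "2 * (z - a i) * x \<le> (z - a i)\<^sup>2 + x\<^sup>2" by (rule sum_squares_bound)
    with True show ?thesis by (simp add: pos_part_def)
  next
    case less: False
    then have "(z - a i) * x \<le> 0" using assms by (simp add: mult_nonpos_nonneg)
    then have "2 * (z - a i) * x - x\<^sup>2 \<le> 0"
      using zero_le_power2[of x] by linarith
    also have "0 \<le> (pos_part (z - a i))\<^sup>2" by simp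
    finally show ?thesis .
  qed
  then show ?thesis using False by (simp add: h_def h_conj_def algebra_simps)
qed

text \<open>
  The supremum over \<open>x\<close> need not be attained: if \<open>z i \<le> a i\<close> and \<open>b i < 0\<close>, it is only
  approached as \<open>x i\<close> tends to \<open>0\<close> from the right, \<open>h\<close> being discontinuous at \<open>0\<close>.
\<close>

lemma h_conj_approx:
  assumes "mono_on {1..k} a" "mono_on {1..k} b" "z \<in> ordered_nonneg k"
  obtains x :: "real \<Rightarrow> nat \<Rightarrow> real" where "\<forall>\<epsilon>>0. x \<epsilon> \<in> ordered_nonneg k"
    "((\<lambda>\<epsilon>. \<Sum>i=1..k. 2 * z i * x \<epsilon> i - (x \<epsilon> i)\<^sup>2 - h a b i (x \<epsilon> i))
       \<longlongrightarrow> (\<Sum>i=1..k. h_conj (a i) (b i) (z i))) (at_right 0)"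
proof -
  define p where "p i = pos_part (z i - a i)" for i
  \<comment> \<open>The branch tests whether a nonzero \<open>x\<close> beats \<open>x = 0\<close>.
    Taking the maximum with \<epsilon> keeps the entry positive even if \<open>p i = 0\<close>, so
    that \<open>h\<close> is evaluated on its nonzero branch.\<close>
  define x where "x \<epsilon> i = (if b i < (p i)\<^sup>2 then max \<epsilon> (p i) else 0)" for \<epsilon> i
  have p_nonneg: "0 \<le> p i" for i by (simp add: p_def pos_part_def)
  show thesis
  proof (rule that[of x], intro allI impI)
    fix \<epsilon> :: real assume \<epsilon>: "0 < \<epsilon>"
    have "x \<epsilon> j \<le> x \<epsilon> i" if "i \<in> {1..k}" "j \<in> {1..k}" "i \<le> j" for i j
    proof -
      \<comment> \<open>Monotonicity of \<open>a\<close> makes \<open>p\<close> non-increasing; with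
        that of \<open>b\<close>, the test \<open>b j < (p j)\<^sup>2\<close> implies the one at
        \<open>i\<close>, so the zero entries come last.\<close>
      have "a i \<le> a j" "b i \<le> b j" "z j \<le> z i"
        using assms that by (auto simp: mono_on_def ordered_nonneg_def)
      then have "p j \<le> p i" by (simp add: p_def pos_part_def)
      then have "(p j)\<^sup>2 \<le> (p i)\<^sup>2" using p_nonneg by (intro power_mono)
      then show ?thesis using \<open>p j \<le> p i\<close> \<open>b i \<le> b j\<close> \<epsilon> by (auto simp: x_def)
    qed
    moreover have "0 \<le> x \<epsilon> i" for i using p_nonneg by (simp add: x_def le_max_iff_disj)
    ultimately show "x \<epsilon> \<in> ordered_nonneg k" by (simp add: ordered_nonneg_def)
  next
    show "((\<lambda>\<epsilon>. \<Sum>i=1..k. 2 * z i * x \<epsilon> i - (x \<epsilon> i)\<^sup>2 - h a b i (x \<epsilon> i))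
       \<longlongrightarrow> (\<Sum>i=1..k. h_conj (a i) (b i) (z i))) (at_right 0)"
    proof (rule tendsto_sum)
      fix i
      show "((\<lambda>\<epsilon>. 2 * z i * x \<epsilon> i - (x \<epsilon> i)\<^sup>2 - h a b i (x \<epsilon> i))
         \<longlongrightarrow> h_conj (a i) (b i) (z i)) (at_right 0)"
      proof (cases "b i < (p i)\<^sup>2")
        case True
        let ?g = "\<lambda>\<epsilon>. 2 * z i * max \<epsilon> (p i) - (max \<epsilon> (p i))\<^sup>2 - (2 * a i * max \<epsilon> (p i) + b i)"
        have "(?g \<longlongrightarrow> ?g 0) (at_right 0)"
          by (intro tendsto_intros)
        moreover have "?g 0 = h_conj (a i) (b i) (z i)"
        proof -
          \<comment> \<open>Either \<open>p i\<close> is \<open>z i - a i\<close> or both sides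
            vanish.\<close>
          have "(z i - a i) * p i = (p i)\<^sup>2"
            by (simp add: p_def pos_part_def max_def power2_eq_square)
          moreover have "max 0 (p i) = p i" using p_nonneg by simp
          moreover have "h_conj (a i) (b i) (z i) = (p i)\<^sup>2 - b i"
            using True by (simp add: h_conj_def p_def)
          ultimately show ?thesis by (simp add: algebra_simps)
        qed
        moreover have "\<forall>\<^sub>F \<epsilon> in at_right 0.
            2 * z i * x \<epsilon> i - (x \<epsilon> i)\<^sup>2 - h a b i (x \<epsilon> i) = ?g \<epsilon>"
          using eventually_at_right_less[of "0::real"]
          by eventually_elim (use True in \<open>auto simp: x_def h_def max_def\<close>)
        ultimately show ?thesis by (simp add: tendsto_cong)
      next
        case False
        then have "h_conj (a i) (b i) (z i) = 0" by (simp add: h_conj_def p_def)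
        with False show ?thesis by (simp add: x_def h_def)
      qed
    qed
  qed
qed

section \<open>The conjugate of \<open>f_h\<close>\<close>

lemma inner_minus_f_h:
  fixes X X0 Y :: "real^'n^'m"
  shows "Y \<bullet> X - f_h a b X0 X =
    2 * (((1/2) *\<^sub>R Y + X0) \<bullet> X) - (norm X)\<^sup>2
    - (\<Sum>i=1..min CARD('m) CARD('n). h a b i (singular_value i X)) - (norm X0)\<^sup>2"
  by (simp add: f_h_def power2_norm_eq_inner inner_diff_left inner_diff_right inner_add_left
      inner_commute[of X0 X])

text \<open>The trace inequality and the scalar bound give the upper estimate. For the lower one,
  matrices aligned with \<open>Z\<close> and having singular values \<open>x \<epsilon>\<close> give
  admissible values that converge to the claimed supremum as \<epsilon> tends to 0.\<close>

lemma fenchel_conjugate_f_h: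
  fixes X0 Y :: "real^'n^'m"
  assumes "mono_on {1..min CARD('m) CARD('n)} a" "mono_on {1..min CARD('m) CARD('n)} b"
  shows "fenchel_conjugate (\<lambda>W. ereal (f_h a b X0 W)) Y = ereal
    ((\<Sum>i=1..min CARD('m) CARD('n). h_conj (a i) (b i) (singular_value i ((1/2) *\<^sub>R Y + X0)))
      - (norm X0)\<^sup>2)" (is "?C = ereal ?L")
proof (rule antisym)
  let ?k = "min CARD('m) CARD('n)"
  define Z where "Z = (1/2) *\<^sub>R Y + X0"
  have val: "Y \<bullet> X - f_h a b X0 X = 2 * (Z \<bullet> X) - (norm X)\<^sup>2
      - (\<Sum>i=1..?k. h a b i (singular_value i X)) - (norm X0)\<^sup>2" for X
    by (simp add: inner_minus_f_h Z_def)
  show "?C \<le> ereal ?L"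
    unfolding fenchel_conjugate_def
  proof (rule SUP_least)
    fix X :: "real^'n^'m"
    have "2 * (Z \<bullet> X) \<le> 2 * (\<Sum>i=1..?k. singular_value i Z * singular_value i X)"
      using von_Neumann_trace_inequality[of Z X] by simp
    then have "2 * (Z \<bullet> X) - (norm X)\<^sup>2 - (\<Sum>i=1..?k. h a b i (singular_value i X)) \<le>
      (\<Sum>i=1..?k. 2 * singular_value i Z * singular_value i X - (singular_value i X)\<^sup>2
        - h a b i (singular_value i X))"
      by (simp add: norm_sq_eq_sum_singular_values sum_subtractf sum_distrib_left mult_ac)
    also have "\<dots> \<le> (\<Sum>i=1..?k. h_conj (a i) (b i) (singular_value i Z))"
      using singular_values_ordered_nonneg[of X]
      by (intro sum_mono h_conj_upper) (auto simp: ordered_nonneg_def)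
    finally show "ereal (Y \<bullet> X) - ereal (f_h a b X0 X) \<le> ereal ?L"
      by (simp add: val Z_def[symmetric])
  qed
  obtain x :: "real \<Rightarrow> nat \<Rightarrow> real" where x: "\<forall>\<epsilon>>0. x \<epsilon> \<in> ordered_nonneg ?k"
    and lim: "((\<lambda>\<epsilon>. \<Sum>i=1..?k. 2 * singular_value i Z * x \<epsilon> i - (x \<epsilon> i)\<^sup>2 - h a b i (x \<epsilon> i))
       \<longlongrightarrow> (\<Sum>i=1..?k. h_conj (a i) (b i) (singular_value i Z))) (at_right 0)"
    by (rule h_conj_approx[OF assms singular_values_ordered_nonneg[of Z]])
  define g where "g \<epsilon> = (\<Sum>i=1..?k. 2 * singular_value i Z * x \<epsilon> i - (x \<epsilon> i)\<^sup>2 - h a b i (x \<epsilon> i))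
      - (norm X0)\<^sup>2" for \<epsilon>
  have "ereal (g \<epsilon>) \<le> ?C" if \<epsilon>: "0 < \<epsilon>" for \<epsilon>
  proof -
    obtain X :: "real^'n^'m" where sv: "\<And>i. i \<in> {1..?k} \<Longrightarrow> singular_value i X = x \<epsilon> i"
      and tr: "Z \<bullet> X = (\<Sum>i=1..?k. singular_value i Z * x \<epsilon> i)"
      using trace_inequality_sharp[OF x[rule_format, OF \<epsilon>], of Z] by blast
    have "g \<epsilon> = Y \<bullet> X - f_h a b X0 X"
      unfolding val tr g_def norm_sq_eq_sum_singular_values[of X]
      by (simp add: sv sum_subtractf sum_distrib_left mult_ac)
    then have "ereal (g \<epsilon>) = ereal (Y \<bullet> X) - ereal (f_h a b X0 X)" by simp
    also have "\<dots> \<le> ?C"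
      unfolding fenchel_conjugate_def by (rule SUP_upper) simp
    finally show ?thesis .
  qed
  then have "\<forall>\<^sub>F \<epsilon> in at_right 0. ereal (g \<epsilon>) \<le> ?C"
    by (intro eventually_mono[OF eventually_at_right_less])
  moreover have "((\<lambda>\<epsilon>. ereal (g \<epsilon>)) \<longlongrightarrow> ereal ?L) (at_right 0)"
    unfolding g_def Z_def[symmetric] by (intro tendsto_ereal tendsto_diff lim tendsto_const)
  ultimately show "ereal ?L \<le> ?C"
    by (intro tendsto_upperbound[where F="at_right (0::real)"]) auto
qed

section \<open>Attainment of the maximum and its reduction to singular values\<close>

lemma maximum_over_eq:
  assumes "x \<in> S" "\<And>y. y \<in> S \<Longrightarrow> f y \<le> f x"
  shows "maximum_over f S = f x"
  unfolding maximum_over_def using assms by (intro Greatest_equality) auto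

text \<open>The terms quadratic in \<open>Z\<close> cancel, leaving a linear term in
  \<open>Z\<close> minus the conjugate found above. In this form the maximum over \<open>Z\<close>
  is recognizable as a biconjugate.\<close>

lemma R_h_objective_eq:
  fixes X Z :: "real^'n^'m"
  shows "R_h_objective a b X Z = 2 * (X \<bullet> Z) - (norm X)\<^sup>2
    - (\<Sum>i=1..min CARD('m) CARD('n). h_conj (a i) (b i) (singular_value i Z))"
  by (simp add: R_h_objective_def h_conj_def sum_subtractf power2_norm_eq_inner inner_diff_left
      inner_diff_right inner_commute[of Z X])

lemma R_h_reduced_objective_eq:
  fixes X :: "real^'n^'m"
  shows "R_h_reduced_objective a b X z =
    (\<Sum>i=1..min CARD('m) CARD('n). 2 * singular_value i X * z i - h_conj (a i) (b i) (z i))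
    - (norm X)\<^sup>2"
  unfolding R_h_reduced_objective_def norm_sq_eq_sum_singular_values h_conj_def
  by (simp add: sum_subtractf[symmetric] power2_diff algebra_simps)

text \<open>From \<open>B\<close> on, the left side is the concave parabola
  \<open>2 * \<sigma> * z - (z - \<alpha>)\<^sup>2 + \<beta>\<close>, whose vertex \<alpha> +
  \<sigma> is at most \<open>B\<close>. Capping at \<open>B\<close> therefore does not lower the
  value.\<close>

lemma h_conj_truncate:
  assumes "0 \<le> \<sigma>" "\<bar>\<alpha>\<bar> + \<bar>\<beta>\<bar> + 1 + \<sigma> \<le> B"
  shows "2 * \<sigma> * z - h_conj \<alpha> \<beta> z \<le> 2 * \<sigma> * min z B - h_conj \<alpha> \<beta> (min z B)"
proof (cases "z \<le> B")
  case False
  have large: "h_conj \<alpha> \<beta> y = (y - \<alpha>)\<^sup>2 - \<beta>" if "B \<le> y" for y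
  proof -
    \<comment> \<open>The summand 1 in the bound makes \<open>y - \<alpha>\<close> at least 1, hence
      at most its own square, which then dominates \<beta>.\<close>
    have y: "\<bar>\<beta>\<bar> + 1 \<le> y - \<alpha>" using assms that by linarith
    then have "\<beta> \<le> (y - \<alpha>)\<^sup>2"
      using self_le_power[of "y - \<alpha>" 2] by (simp, linarith)
    then show ?thesis using y by (simp add: h_conj_def pos_part_def)
  qed
  \<comment> \<open>This product is the difference of the parabola's values at \<open>z\<close> and
    at \<open>B\<close>.\<close>
  have "(z - B) * (2 * \<sigma> - (z - \<alpha>) - (B - \<alpha>)) \<le> 0"
    using False assms by (intro mult_nonneg_nonpos) auto
  then have "2 * \<sigma> * z - (z - \<alpha>)\<^sup>2 \<le> 2 * \<sigma> * B - (B - \<alpha>)\<^sup>2"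
    by (simp add: power2_eq_square algebra_simps)
  then show ?thesis using False by (simp add: large)
qed simp

text \<open>The vectors are functions on all naturals, so the coordinates outside
  \<open>{1..k}\<close> are pinned to 0. The box is then compact by Tychonoff, and the order
  conditions are closed in the product topology.\<close>

lemma compact_bounded_ordered_nonneg:
  "compact {z \<in> ordered_nonneg k. \<forall>i. z i \<in> (if i \<in> {1..k} then {0..B} else {0})}"
proof -
  let ?S = "\<lambda>i. if i \<in> {1..k} then {0..B} else {0::real}"
  have "compactin (product_topology (\<lambda>_. euclidean) UNIV) (PiE UNIV ?S)"
    by (subst compactin_PiE) auto
  then have "compact (PiE UNIV ?S)"
    by (simp add: euclidean_product_topology)
  moreover have "closed (ordered_nonneg k)"
  proof -
    have "ordered_nonneg k = (\<Inter>i\<in>{1..k}. \<Inter>j\<in>{i..k}. {z. z j \<le> z i}) \<inter> (\<Inter>i\<in>{1..k}. {z. 0 \<le> z i})"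
      by (auto simp: ordered_nonneg_def)
    then show ?thesis
      by (auto intro!: closed_Int closed_INT closed_Collect_le)
  qed
  ultimately have "compact (PiE UNIV ?S \<inter> ordered_nonneg k)"
    by (rule compact_Int_closed)
  moreover have "PiE UNIV ?S \<inter> ordered_nonneg k = {z \<in> ordered_nonneg k. \<forall>i. z i \<in> ?S i}"
    by (auto simp: PiE_def Pi_def)
  ultimately show ?thesis by simp
qed

lemma continuous_R_h_reduced_objective: "continuous_on A (R_h_reduced_objective a b X)"
  unfolding R_h_reduced_objective_def pos_part_def
  by (intro continuous_intros continuous_on_subset[OF continuous_on_product_coordinates subset_UNIV])

text \<open>Capping every coordinate at a common bound preserves the order and does not decrease the
  objective, so a maximizer on a compact set is a global one.\<close>

lemma R_h_reduced_attains_max: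
  fixes X :: "real^'n^'m"
  shows "attains_max (R_h_reduced_objective a b X) (ordered_nonneg (min CARD('m) CARD('n)))"
proof -
  let ?k = "min CARD('m) CARD('n)"
  let ?f = "R_h_reduced_objective a b X"
  have sv: "0 \<le> singular_value i X" if "i \<in> {1..?k}" for i
    using singular_values_ordered_nonneg[of X] that by (simp add: ordered_nonneg_def)
  \<comment> \<open>A sum of nonnegative terms dominates each of them, so one \<open>B\<close>
    serves every index.\<close>
  define B where "B = (\<Sum>i=1..?k. \<bar>a i\<bar> + \<bar>b i\<bar> + 1 + singular_value i X)"
  have "0 \<le> B" unfolding B_def by (rule sum_nonneg) (use sv in force)
  have B: "\<bar>a i\<bar> + \<bar>b i\<bar> + 1 + singular_value i X \<le> B" if "i \<in> {1..?k}" for i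
    unfolding B_def
    by (rule member_le_sum[where f="\<lambda>i. \<bar>a i\<bar> + \<bar>b i\<bar> + 1 + singular_value i X"])
      (use that sv in force)+
  define K where "K = {z \<in> ordered_nonneg ?k. \<forall>i. z i \<in> (if i \<in> {1..?k} then {0..B} else {0})}"
  have "(\<lambda>i. 0) \<in> K" using \<open>0 \<le> B\<close> by (auto simp: K_def ordered_nonneg_def)
  then obtain z where z: "z \<in> K" "\<And>y. y \<in> K \<Longrightarrow> ?f y \<le> ?f z"
    using continuous_attains_sup[OF _ _ continuous_R_h_reduced_objective, of K a b X]
      compact_bounded_ordered_nonneg[of ?k B] unfolding K_def[symmetric] by blast
  have "?f y \<le> ?f z" if y: "y \<in> ordered_nonneg ?k" for y
  proof -
    define y' where "y' i = (if i \<in> {1..?k} then min (y i) B else 0)" for i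
    have "y' \<in> K"
      using y \<open>0 \<le> B\<close> by (auto simp: K_def y'_def ordered_nonneg_def min_le_iff_disj)
    have "?f y \<le> ?f y'"
      unfolding R_h_reduced_objective_eq
      by (intro diff_right_mono sum_mono) (simp add: y'_def h_conj_truncate sv B)
    also have "\<dots> \<le> ?f z" using \<open>y' \<in> K\<close> by (rule z(2))
    finally show ?thesis .
  qed
  then show ?thesis using z(1) by (auto simp: attains_max_def K_def)
qed

text \<open>Apart from the inner product \<open>X \<bullet> Z\<close>, which the trace inequality
  bounds, the objective depends on \<open>X\<close> and \<open>Z\<close> only through their singular
  values.\<close>

lemma R_h_objective_le_reduced:
  fixes X Z :: "real^'n^'m"
  shows "R_h_objective a b X Z \<le> R_h_reduced_objective a b X (\<lambda>i. singular_value i Z)"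
  using von_Neumann_trace_inequality[of X Z]
  by (simp add: R_h_objective_eq R_h_reduced_objective_eq sum_subtractf sum_distrib_left mult.assoc
      flip: sum_distrib_left)

text \<open>Sharpness of the trace inequality supplies a \<open>Z\<close> aligned with
  \<open>X\<close>, so a maximizer of the reduced problem lifts to one over matrices.\<close>

lemma R_h_objective_lift:
  fixes X :: "real^'n^'m"
  assumes "z \<in> ordered_nonneg (min CARD('m) CARD('n))"
  obtains Z where "R_h_objective a b X Z = R_h_reduced_objective a b X z"
proof -
  let ?k = "min CARD('m) CARD('n)"
  obtain Z :: "real^'n^'m" where "\<And>i. i \<in> {1..?k} \<Longrightarrow> singular_value i Z = z i"
    "X \<bullet> Z = (\<Sum>i=1..?k. singular_value i X * z i)"
    using trace_inequality_sharp[OF assms, of X] by blast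
  then have "R_h_objective a b X Z = R_h_reduced_objective a b X z"
    by (simp add: R_h_objective_eq R_h_reduced_objective_eq sum_subtractf mult.assoc
        flip: sum_distrib_left)
  then show thesis by (rule that)
qed

theorem mainTheorem1:
  fixes X0 :: "real^'n^'m" and a b :: "nat \<Rightarrow> real"
  assumes "mono_on {1..min CARD('m) CARD('n)} a"
    and "mono_on {1..min CARD('m) CARD('n)} b"
  shows "\<forall>X :: real^'n^'m.
      fenchel_biconjugate (\<lambda>W. ereal (f_h a b X0 W)) X = ereal (R_h a b X + (norm (X - X0))\<^sup>2)
    \<and> attains_max (R_h_objective a b X) UNIV
    \<and> attains_max (R_h_reduced_objective a b X) (ordered_nonneg (min CARD('m) CARD('n)))
    \<and> R_h a b X =
        maximum_over (R_h_reduced_objective a b X) (ordered_nonneg (min CARD('m) CARD('n)))"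
proof
  fix X :: "real^'n^'m"
  let ?k = "min CARD('m) CARD('n)"
  obtain z where z: "z \<in> ordered_nonneg ?k"
    and max: "\<And>y. y \<in> ordered_nonneg ?k \<Longrightarrow>
      R_h_reduced_objective a b X y \<le> R_h_reduced_objective a b X z"
    using R_h_reduced_attains_max[of a b X] by (auto simp: attains_max_def)
  obtain Z where Z: "R_h_objective a b X Z = R_h_reduced_objective a b X z"
    using R_h_objective_lift[OF z] .
  have Z_max: "R_h_objective a b X W \<le> R_h_objective a b X Z" for W
    using order_trans[OF R_h_objective_le_reduced max[OF singular_values_ordered_nonneg]]
    by (simp add: Z)
  have R: "R_h a b X = R_h_objective a b X Z"
    unfolding R_h_def by (rule maximum_over_eq) (use Z_max in auto)
  \<comment> \<open>With \<open>Z = (1/2) *\<^sub>R Y + X0\<close>, the remaining terms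
    \<open>(norm X)\<^sup>2 - 2 * (X \<bullet> X0) + (norm X0)\<^sup>2\<close> form the square of
    the distance from \<open>X\<close> to \<open>X0\<close>.\<close>
  have val: "ereal (X \<bullet> Y) - fenchel_conjugate (\<lambda>W. ereal (f_h a b X0 W)) Y =
      ereal (R_h_objective a b X ((1/2) *\<^sub>R Y + X0) + (norm (X - X0))\<^sup>2)" for Y
    by (simp add: fenchel_conjugate_f_h[OF assms] R_h_objective_eq power2_norm_eq_inner
        inner_add_right inner_diff_left inner_diff_right inner_commute[of X0 X])
  have "fenchel_biconjugate (\<lambda>W. ereal (f_h a b X0 W)) X = ereal (R_h a b X + (norm (X - X0))\<^sup>2)"
    unfolding fenchel_biconjugate_def
      fenchel_conjugate_def[of "fenchel_conjugate (\<lambda>W. ereal (f_h a b X0 W))"] val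
  proof (rule antisym)
    show "(SUP Y. ereal (R_h_objective a b X ((1/2) *\<^sub>R Y + X0) + (norm (X - X0))\<^sup>2))
        \<le> ereal (R_h a b X + (norm (X - X0))\<^sup>2)"
      by (rule SUP_least) (simp add: R Z_max)
    show "ereal (R_h a b X + (norm (X - X0))\<^sup>2)
        \<le> (SUP Y. ereal (R_h_objective a b X ((1/2) *\<^sub>R Y + X0) + (norm (X - X0))\<^sup>2))"
      \<comment> \<open>The dual point that the substitution sends to the maximizer
        \<open>Z\<close>.\<close>
      by (rule SUP_upper2[of "2 *\<^sub>R (Z - X0)"]) (simp_all add: R)
  qed
  moreover have "attains_max (R_h_objective a b X) UNIV"
    using Z_max by (auto simp: attains_max_def)
  moreover have "maximum_over (R_h_reduced_objective a b X) (ordered_nonneg ?k) =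
      R_h_reduced_objective a b X z"
    by (rule maximum_over_eq) (use z max in auto)
  ultimately show "fenchel_biconjugate (\<lambda>W. ereal (f_h a b X0 W)) X =
        ereal (R_h a b X + (norm (X - X0))\<^sup>2)
    \<and> attains_max (R_h_objective a b X) UNIV
    \<and> attains_max (R_h_reduced_objective a b X) (ordered_nonneg ?k)
    \<and> R_h a b X = maximum_over (R_h_reduced_objective a b X) (ordered_nonneg ?k)"
    using R_h_reduced_attains_max R Z by simp
qed

end
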